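(* Let $k\ge 1$, let $f:\mathbb{R}\to\mathbb{R}$ be continuous, and let $I_1,\ldots,I_k\subset\mathbb{R}$ be nonempty bounded closed intervals such that $(I_1,\ldots,I_k;f)$ is a covering system, i.e. $f(I_1\cup\cdots\cup I_k)\supseteq I_1\cup\cdots\cup I_k$. Then there exist $x_0\in I_1\cup\cdots\cup I_k$ and an integer $l$ with $1\le l\le k$ such that $f^l(x_0)=x_0$.
   Context: $f^l$ denotes the $l$-th iterate of $f$ (the $l$-fold composition of $f$ with itself). A tuple $(I_1,\ldots,I_k;f)$ consisting of closed intervals $I_1,\ldots,I_k$ and a continuous map $f:\mathbb{R}\to\mathbb{R}$ is called a covering system if $f(I_1\cup\cdots\cup I_k)\supseteq I_1\cup\cdots\cup I_k$. *)

theory Defs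
  imports "HOL-Analysis.Analysis"
begin

(* The tuple (I_1, ..., I_k; f) is given by k and a family I of which only the values
   at 1, ..., k matter. Closed intervals may here be empty, degenerate or unbounded. *)
definition covering_system :: "nat \<Rightarrow> (nat \<Rightarrow> real set) \<Rightarrow> (real \<Rightarrow> real) \<Rightarrow> bool" where
  "covering_system k I f \<longleftrightarrow>
     (\<forall>i\<in>{1..k}. is_interval (I i) \<and> closed (I i)) \<and>
     continuous_on UNIV f \<and>
     (\<Union>i\<in>{1..k}. I i) \<subseteq> f ` (\<Union>i\<in>{1..k}. I i)"

end

(* If f maps a finite subset p 0 < ... < p M of the union U of the k intervals to itself, the signed
   counts with which the edges [p i, p (i+1)] cross each other under f form an integer matrix whose
   l-th power belongs in the same way to the l-th iterate, and whose trace telescopes to -1 when that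
   iterate has no fixed point among the p i. At most k - 1 edges are not contained in one of the
   intervals. A closed walk of length l through any other edge yields a fixed point of the l-th
   iterate in U; if there is none for l \<le> k, then only walks along the at most k - 1 remaining edges
   contribute to the traces, so a matrix Q of size less than k satisfies tr (Q^l) = -1 for
   l = 1, ..., k. Enlarged by an additional eigenvalue 1 it would be nilpotent, which is absurd.

   In general, a backward orbit inside the compact set U comes arbitrarily close to itself. This
   gives a finite subset of U invariant under an arbitrarily small perturbation of f, and the absence
   of points of period at most k in U is stable under small perturbations. *)
theory Submission
  imports Defs "Jordan_Normal_Form.Schur_Decomposition"
begin

section \<open>Power sums of eigenvalues and traces of matrix powers\<close>

text \<open>Otherwise the list \<open>e\<close> enlarged by one entry 1 has vanishing power sums for
  all exponents from 1 to n + 1, so every polynomial of degree at most n + 1 without constant term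
  sums to 0 over it. The polynomial \<open>q\<close> vanishes at 0 and at every entry other than 1,
  which leaves only the entries equal to 1.\<close>

lemma power_sums_ne_minus_one:
  fixes e :: "nat \<Rightarrow> complex"
  shows "\<exists>l\<in>{1..n + 1}. (\<Sum>i<n. e i ^ l) \<noteq> -1"
proof (rule ccontr)
  assume "\<not> ?thesis"
  then have sums: "(\<Sum>i<n. e i ^ l) = -1" if "l \<in> {1..n + 1}" for l
    using that by blast
  define M where "M = e ` {..<n} - {1}"
  define q where "q = [:0, 1:] * (\<Prod>\<mu>\<in>M. [:- \<mu>, 1:])"
  have fin: "finite M" by (simp add: M_def)
  have "degree q \<le> 1 + card M"
  proof -
    have "degree q \<le> degree [:0, 1 :: complex:] + degree (\<Prod>\<mu>\<in>M. [:- \<mu>, 1:])"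
      unfolding q_def by (rule degree_mult_le)
    also have "degree (\<Prod>\<mu>\<in>M. [:- \<mu>, 1:]) \<le> (\<Sum>\<mu>\<in>M. degree [:- \<mu>, 1:])"
      using degree_prod_sum_le[OF fin, of "\<lambda>\<mu>. [:- \<mu>, 1:]"] by (simp add: o_def)
    finally show ?thesis by simp
  qed
  moreover have "card M \<le> n"
    using card_mono[of "e ` {..<n}" M] card_image_le[of "{..<n}" e] by (auto simp: M_def)
  ultimately have deg: "degree q \<le> n + 1" by simp
  have eval: "poly q x = (\<Sum>l\<le>n + 1. coeff q l * x ^ l)" for x
    unfolding poly_altdef
    by (rule sum.mono_neutral_left) (use deg in \<open>auto simp: coeff_eq_0\<close>)
  have q0: "coeff q 0 = 0"
    by (simp add: q_def coeff_mult)
  \<comment> \<open>The summand \<open>poly q 1\<close> belongs to the added entry. The factor X of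
    \<open>q\<close> removes the exponent 0, about which \<open>sums\<close> says nothing.\<close>
  have "(\<Sum>i<n. poly q (e i)) + poly q 1 = (\<Sum>l\<le>n + 1. coeff q l * ((\<Sum>i<n. e i ^ l) + 1))"
    by (simp only: eval sum.swap[of _ "{..n + 1}" "{..<n}"] sum_distrib_left distrib_left
          sum.distrib power_one)
  also have "\<dots> = 0"
  proof (rule sum.neutral, intro ballI)
    fix l assume "l \<in> {..n + 1}"
    then show "coeff q l * ((\<Sum>i<n. e i ^ l) + 1) = 0"
      using sums[of l] q0 by (cases "l = 0") auto
  qed
  finally have zero: "(\<Sum>i<n. poly q (e i)) + poly q 1 = 0" .
  have root: "poly q (e i) = (if e i = 1 then poly q 1 else 0)" if "i < n" for i
    using that fin by (auto simp: q_def poly_prod M_def)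
  have "(\<Sum>i<n. poly q (e i)) = (\<Sum>i<n. if e i = 1 then poly q 1 else 0)"
    by (rule sum.cong) (simp_all add: root)
  also have "\<dots> = of_nat (card {i\<in>{..<n}. e i = 1}) * poly q 1"
    by (simp add: sum.If_cases Int_def)
  finally have "(of_nat (card {i\<in>{..<n}. e i = 1}) + 1) * poly q 1 = 0"
    using zero by (simp add: algebra_simps)
  moreover have "poly q 1 \<noteq> 0"
    using fin by (auto simp: q_def poly_prod M_def)
  moreover have "of_nat (card {i\<in>{..<n}. e i = 1}) + 1 \<noteq> (0 :: complex)"
    by (metis of_nat_Suc of_nat_eq_0_iff old.nat.distinct(2) add.commute)
  ultimately show False by simp
qed

lemma upper_triangular_mult_diag:
  fixes A B :: "'a :: semiring_0 mat"
  assumes A: "A \<in> carrier_mat n n" "upper_triangular A"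
    and B: "B \<in> carrier_mat n n" "upper_triangular B"
  shows "upper_triangular (A * B)"
    and "i < n \<Longrightarrow> (A * B) $$ (i, i) = A $$ (i, i) * B $$ (i, i)"
proof -
  have prod: "(A * B) $$ (i, j) = (\<Sum>k\<in>{0..<n}. A $$ (i, k) * B $$ (k, j))"
    if "i < n" "j < n" for i j
    using that A B by (simp add: scalar_prod_def)
  have zero: "A $$ (i, k) * B $$ (k, j) = 0" if "i < n" "j < n" "k < n" "k < i \<or> j < k" for i j k
    using that A B by (auto simp: upper_triangularD)
  show "upper_triangular (A * B)"
  proof (rule upper_triangularI)
    fix i j assume "j < i" "i < dim_row (A * B)"
    then have *: "j < i" "i < n" "j < n" using A by auto
    have "A $$ (i, k) * B $$ (k, j) = 0" if "k < n" for k
      by (rule zero) (use * that in auto)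
    then show "(A * B) $$ (i, j) = 0"
      using * by (simp add: prod)
  qed
  assume i: "i < n"
  have "(A * B) $$ (i, i) = (\<Sum>k\<in>{i}. A $$ (i, k) * B $$ (k, i))"
    unfolding prod[OF i i]
    by (rule sum.mono_neutral_right) (use i zero[OF i i] in \<open>auto simp: neq_iff\<close>)
  then show "(A * B) $$ (i, i) = A $$ (i, i) * B $$ (i, i)" by simp
qed

lemma upper_triangular_pow_diag:
  fixes B :: "'a :: semiring_1 mat"
  assumes B: "B \<in> carrier_mat n n" "upper_triangular B"
  shows "upper_triangular (B ^\<^sub>m l) \<and> (\<forall>i<n. (B ^\<^sub>m l) $$ (i, i) = B $$ (i, i) ^ l)"
proof (induction l)
  case 0
  then show ?case using B by auto
next
  case (Suc l)
  then show ?case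
    using upper_triangular_mult_diag[of "B ^\<^sub>m l" n B] B
    by (auto simp: power_commutes simp del: power_Suc intro: power_Suc2[symmetric])
qed

lemma sum_diag_mult_commute:
  fixes A B :: "'a :: comm_semiring_0 mat"
  assumes "A \<in> carrier_mat n n" "B \<in> carrier_mat n n"
  shows "(\<Sum>i<n. (A * B) $$ (i, i)) = (\<Sum>i<n. (B * A) $$ (i, i))"
proof -
  have "(\<Sum>i<n. (A * B) $$ (i, i)) = (\<Sum>i<n. \<Sum>k<n. A $$ (i, k) * B $$ (k, i))"
    using assms by (simp add: scalar_prod_def atLeast0LessThan)
  also have "\<dots> = (\<Sum>k<n. \<Sum>i<n. B $$ (k, i) * A $$ (i, k))"
    by (subst sum.swap) (simp add: mult.commute)
  also have "\<dots> = (\<Sum>i<n. (B * A) $$ (i, i))"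
    using assms by (simp add: scalar_prod_def atLeast0LessThan)
  finally show ?thesis .
qed

text \<open>\<open>e\<close> lists the diagonal of a Schur form of \<open>A\<close>, hence serves
  all exponents at once: powers of a triangular matrix have the powers of its diagonal entries on
  the diagonal, and cyclicity of the trace removes the conjugation.\<close>

lemma sum_diag_pow_eq_power_sum:
  fixes A :: "complex mat"
  assumes A: "A \<in> carrier_mat n n"
  obtains e where "\<And>l. (\<Sum>i<n. (A ^\<^sub>m l) $$ (i, i)) = (\<Sum>i<n. e i ^ l)"
proof -
  obtain as where "char_poly A = (\<Prod>a\<leftarrow>as. [:- a, 1:])"
    using char_poly_factorized[OF A] by blast
  then obtain B where B: "B \<in> carrier_mat n n" "upper_triangular B" "similar_mat A B"
    using schur_decomposition_exists[OF A] by blast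
  then obtain P Q where wit: "similar_mat_wit A B P Q"
    by (auto simp: similar_mat_def)
  note w = similar_mat_witD2[OF A wit]
  have "(\<Sum>i<n. (A ^\<^sub>m l) $$ (i, i)) = (\<Sum>i<n. B $$ (i, i) ^ l)" for l
  proof -
    have Bl: "B ^\<^sub>m l \<in> carrier_mat n n" using B by simp
    have "(\<Sum>i<n. (A ^\<^sub>m l) $$ (i, i)) = (\<Sum>i<n. (P * B ^\<^sub>m l * Q) $$ (i, i))"
      by (simp only: similar_mat_wit_pow_id[OF wit])
    also have "\<dots> = (\<Sum>i<n. (Q * (P * B ^\<^sub>m l)) $$ (i, i))"
      by (rule sum_diag_mult_commute) (use w Bl in auto)
    also have "Q * (P * B ^\<^sub>m l) = (Q * P) * B ^\<^sub>m l"
      by (rule assoc_mult_mat[symmetric]) (use w Bl in auto)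
    also have "\<dots> = B ^\<^sub>m l" using w Bl by simp
    finally show ?thesis using upper_triangular_pow_diag[OF B(1,2)] by simp
  qed
  then show thesis by (rule that)
qed

section \<open>Weighted walks and restriction to a subset of the vertices\<close>

text \<open>For i and j in \<open>V\<close> this is an entry of the m-th power of the matrix
  \<open>w\<close> indexed by \<open>V\<close>. With the index set as a parameter, passing to a
  principal submatrix only replaces \<open>V\<close>.\<close>

primrec walk_weight :: "'v set \<Rightarrow> ('v \<Rightarrow> 'v \<Rightarrow> int) \<Rightarrow> nat \<Rightarrow> 'v \<Rightarrow> 'v \<Rightarrow> int" where
  "walk_weight V w 0 i j = (if i = j then 1 else 0)"
| "walk_weight V w (Suc m) i j = (\<Sum>b\<in>V. walk_weight V w m i b * w b j)"

text \<open>Numbering \<open>V\<close> turns the sum into the trace of a matrix power, that is, a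
  power sum of \<open>card V\<close> eigenvalues. The entries are cast to complex numbers so that
  the characteristic polynomial splits.\<close>

lemma closed_walk_weight_ne_minus_one:
  assumes "finite V"
  shows "\<exists>l\<in>{1..card V + 1}. (\<Sum>i\<in>V. walk_weight V w l i i) \<noteq> -1"
proof -
  define n where "n = card V"
  obtain h where h: "bij_betw h {..<n} V"
    using ex_bij_betw_nat_finite[OF assms] by (auto simp: n_def atLeast0LessThan)
  define A where "A = mat n n (\<lambda>(i, j). complex_of_int (w (h i) (h j)))"
  have A: "A \<in> carrier_mat n n" by (simp add: A_def)
  have pow: "(A ^\<^sub>m l) $$ (i, j) = of_int (walk_weight V w l (h i) (h j))"
    if "i < n" "j < n" for l i j
    using that
  proof (induction l arbitrary: j)
    case 0
    then show ?case
      using h A by (auto simp: bij_betw_def inj_on_def A_def)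
  next
    case (Suc l)
    have "(A ^\<^sub>m Suc l) $$ (i, j) = (\<Sum>b<n. (A ^\<^sub>m l) $$ (i, b) * A $$ (b, j))"
      using Suc.prems A pow_carrier_mat[OF A, of l]
      by (simp add: scalar_prod_def atLeast0LessThan del: pow_carrier_mat)
    also have "\<dots> = (\<Sum>b<n. of_int (walk_weight V w l (h i) (h b) * w (h b) (h j)))"
      using Suc by (intro sum.cong) (auto simp: A_def)
    also have "\<dots> = (\<Sum>b\<in>V. of_int (walk_weight V w l (h i) b * w b (h j)))"
      by (rule sum.reindex_bij_betw[OF h])
    finally show ?case by simp
  qed
  obtain e where e: "\<And>l. (\<Sum>i<n. (A ^\<^sub>m l) $$ (i, i)) = (\<Sum>i<n. e i ^ l)"
    using sum_diag_pow_eq_power_sum[OF A] by blast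
  have "(\<Sum>i<n. e i ^ l) = of_int (\<Sum>i\<in>V. walk_weight V w l i i)" for l
  proof -
    have "(\<Sum>i<n. e i ^ l) = (\<Sum>i<n. of_int (walk_weight V w l (h i) (h i)))"
      using e[of l] by (simp add: pow)
    also have "\<dots> = (\<Sum>i\<in>V. of_int (walk_weight V w l i i))"
      by (rule sum.reindex_bij_betw[OF h])
    finally show ?thesis by simp
  qed
  moreover obtain l where l: "l \<in> {1..n + 1}" "(\<Sum>i<n. e i ^ l) \<noteq> -1"
    using power_sums_ne_minus_one[of n e] by blast
  ultimately have "(\<Sum>i\<in>V. walk_weight V w l i i) \<noteq> -1"
    by (metis of_int_1 of_int_minus)
  then show ?thesis using l(1) unfolding n_def by blast
qed


abbreviation support_rel :: "'v set \<Rightarrow> ('v \<Rightarrow> 'v \<Rightarrow> int) \<Rightarrow> 'v rel" where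
  "support_rel V w \<equiv> {(i, j). i \<in> V \<and> j \<in> V \<and> w i j \<noteq> 0}"

lemma walk_weight_nonzero_imp_relpow:
  assumes "walk_weight V w m i j \<noteq> 0" "i \<in> V" "j \<in> V"
  shows "(i, j) \<in> support_rel V w ^^ m"
  using assms
proof (induction m arbitrary: j)
  case 0
  then show ?case by (simp split: if_splits)
next
  case (Suc m)
  then obtain b where "b \<in> V" "walk_weight V w m i b * w b j \<noteq> 0"
    by (auto elim: sum.not_neutral_contains_not_neutral)
  with Suc show ?case by (auto intro!: relcompI[of _ b])
qed

text \<open>A walk that visits some b outside \<open>G\<close> splits at b into a walk from i to b
  and one from b to j. The last hypothesis excludes this, so only walks inside \<open>G\<close>
  contribute.\<close>

lemma walk_weight_restrict:
  assumes "finite V" "G \<subseteq> V" "i \<in> V" "j \<in> V"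
    and "\<And>b s t. b \<in> V - G \<Longrightarrow> s + t = m \<Longrightarrow>
      \<not> ((i, b) \<in> support_rel V w ^^ s \<and> (b, j) \<in> support_rel V w ^^ t)"
  shows "walk_weight V w m i j = walk_weight G w m i j"
  using assms(4,5)
proof (induction m arbitrary: j)
  case 0
  then show ?case by simp
next
  case (Suc m)
  have step: "(b, j) \<in> support_rel V w" if "b \<in> V" "w b j \<noteq> 0" for b
    using that Suc.prems(1) by simp
  have "(\<Sum>b\<in>V. walk_weight V w m i b * w b j) = (\<Sum>b\<in>G. walk_weight V w m i b * w b j)"
  proof (rule sum.mono_neutral_right[OF assms(1,2)], intro ballI)
    fix b assume b: "b \<in> V - G"
    show "walk_weight V w m i b * w b j = 0"
    proof (rule ccontr)
      assume "walk_weight V w m i b * w b j \<noteq> 0"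
      then have "(i, b) \<in> support_rel V w ^^ m" "(b, j) \<in> support_rel V w ^^ 1"
        using walk_weight_nonzero_imp_relpow[of V w m i b] step[of b] b assms(3) by auto
      then show False using Suc.prems(2)[OF b, of m 1] by simp
    qed
  qed
  also have "\<dots> = (\<Sum>b\<in>G. walk_weight G w m i b * w b j)"
  proof (rule sum.cong[OF refl])
    fix b assume b: "b \<in> G"
    show "walk_weight V w m i b * w b j = walk_weight G w m i b * w b j"
    proof (cases "w b j = 0")
      case False
      have "walk_weight V w m i b = walk_weight G w m i b"
      proof (rule Suc.IH)
        show "b \<in> V" using b assms(2) by blast
        fix c s t
        assume c: "c \<in> V - G" and st: "s + t = m"
        show "\<not> ((i, c) \<in> support_rel V w ^^ s \<and> (c, b) \<in> support_rel V w ^^ t)"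
          using Suc.prems(2)[OF c, of s "Suc t"] st step[OF \<open>b \<in> V\<close> False] by auto
      qed
      then show ?thesis by simp
    qed simp
  qed
  finally show ?case by simp
qed

text \<open>A closed walk from i through b can be rotated into a closed walk of the same length from
  b. Hence it suffices to exclude closed walks based at vertices outside \<open>G\<close>.\<close>

lemma closed_walk_weight_restrict:
  assumes "finite V" "G \<subseteq> V"
    and "\<And>b. b \<in> V - G \<Longrightarrow> (b, b) \<notin> support_rel V w ^^ m"
  shows "(\<Sum>i\<in>V. walk_weight V w m i i) = (\<Sum>i\<in>G. walk_weight G w m i i)"
proof -
  have "(\<Sum>i\<in>V. walk_weight V w m i i) = (\<Sum>i\<in>G. walk_weight V w m i i)"
    by (rule sum.mono_neutral_right[OF assms(1,2)])
      (use assms(3) walk_weight_nonzero_imp_relpow in fastforce)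
  also have "\<dots> = (\<Sum>i\<in>G. walk_weight G w m i i)"
  proof (rule sum.cong[OF refl])
    fix i assume "i \<in> G"
    show "walk_weight V w m i i = walk_weight G w m i i"
    proof (rule walk_weight_restrict[OF assms(1,2)])
      show "i \<in> V" "i \<in> V" using \<open>i \<in> G\<close> assms(2) by auto
      fix b s t
      assume b: "b \<in> V - G" and st: "s + t = m"
      show "\<not> ((i, b) \<in> support_rel V w ^^ s \<and> (b, i) \<in> support_rel V w ^^ t)"
      proof
        assume "(i, b) \<in> support_rel V w ^^ s \<and> (b, i) \<in> support_rel V w ^^ t"
        then have "(b, b) \<in> support_rel V w ^^ (t + s)"
          unfolding relpow_add by blast
        then show False using assms(3)[OF b] st by (simp add: add.commute)
      qed
    qed
  qed
  finally show ?thesis .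
qed

section \<open>Signed edge crossings of a self-map of a finite ordered set\<close>

text \<open>The value is 1, -1 or 0 according to whether the path from \<phi> i to \<phi> (i + 1)
  crosses the edge from j to j + 1 upwards, downwards or not at all. Being a difference in i, it
  makes the sums below telescope.\<close>

definition edge_cover :: "(nat \<Rightarrow> nat) \<Rightarrow> nat \<Rightarrow> nat \<Rightarrow> int" where
  "edge_cover \<phi> i j = of_bool (j < \<phi> (Suc i)) - of_bool (j < \<phi> i)"

lemma sum_of_bool_telescope:
  fixes u :: "nat \<Rightarrow> int"
  assumes "x \<le> M"
  shows "(\<Sum>b<M. of_bool (b < x) * (u (Suc b) - u b)) = u x - u 0"
proof -
  have "(\<Sum>b<M. of_bool (b < x) * (u (Suc b) - u b)) = (\<Sum>b<x. u (Suc b) - u b)"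
    by (rule sum.mono_neutral_cong_right) (use assms in auto)
  then show ?thesis by (simp add: sum_lessThan_telescope)
qed

lemma funpow_atMost:
  fixes \<theta> :: "nat \<Rightarrow> nat"
  assumes "\<And>x. x \<le> M \<Longrightarrow> \<theta> x \<le> M" "x \<le> M"
  shows "(\<theta> ^^ l) x \<le> M"
  by (induction l) (simp_all add: assms)

text \<open>The matrices describe the action on the edges of a path, so composition of maps becomes
  multiplication of matrices. Concretely, the increments of \<open>u\<close> along the path from
  \<phi> i to \<phi> (i + 1) add up to the difference of \<open>u\<close> at its ends.\<close>

lemma walk_weight_edge_cover:
  assumes \<theta>: "\<And>x. x \<le> M \<Longrightarrow> \<theta> x \<le> M" and "i < M" "j < M"
  shows "walk_weight {..<M} (edge_cover \<theta>) l i j = edge_cover (\<theta> ^^ l) i j"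
  using assms(3)
proof (induction l arbitrary: j)
  case 0
  then show ?case by (auto simp: edge_cover_def)
next
  case (Suc l)
  define u where "u x = (of_bool (j < \<theta> x) :: int)" for x
  define \<phi> where "\<phi> = \<theta> ^^ l"
  have "walk_weight {..<M} (edge_cover \<theta>) (Suc l) i j
      = (\<Sum>b<M. edge_cover \<phi> i b * (u (Suc b) - u b))"
    by (simp add: Suc.IH \<phi>_def u_def edge_cover_def[of \<theta>])
  also have "\<dots> = (\<Sum>b<M. of_bool (b < \<phi> (Suc i)) * (u (Suc b) - u b))
      - (\<Sum>b<M. of_bool (b < \<phi> i) * (u (Suc b) - u b))"
    by (simp add: edge_cover_def left_diff_distrib sum_subtractf)
  also have "\<dots> = (u (\<phi> (Suc i)) - u 0) - (u (\<phi> i) - u 0)"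
    using assms(2) by (simp only: sum_of_bool_telescope \<phi>_def funpow_atMost[OF \<theta>] Suc_leI less_imp_le)
  also have "\<dots> = edge_cover (\<theta> ^^ Suc l) i j"
    by (simp add: u_def edge_cover_def \<phi>_def)
  finally show ?case .
qed

text \<open>Without fixed points, the diagonal entry at i is the increment of \<open>u\<close> from
  i to i + 1; and \<open>u\<close> is 1 at 0 and 0 at M. This is the Lefschetz formula for a
  segment: the number of fixed vertices minus the trace on edges is 1.\<close>

lemma sum_edge_cover_diag:
  assumes "\<And>x. x \<le> M \<Longrightarrow> \<phi> x \<le> M" "\<And>x. x \<le> M \<Longrightarrow> \<phi> x \<noteq> x"
  shows "(\<Sum>i<M. edge_cover \<phi> i i) = -1"
proof -
  define u where "u i = (of_bool (i < \<phi> i) :: int)" for i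
  have "edge_cover \<phi> i i = u (Suc i) - u i" if "i < M" for i
  proof -
    have "i < \<phi> (Suc i) \<longleftrightarrow> Suc i < \<phi> (Suc i)"
      using assms(2)[of "Suc i"] that by auto
    then show ?thesis by (simp add: edge_cover_def u_def)
  qed
  then have "(\<Sum>i<M. edge_cover \<phi> i i) = u M - u 0"
    by (simp add: sum_lessThan_telescope)
  also have "\<dots> = -1"
    using assms(1)[of M] assms(2)[of 0] by (simp add: u_def)
  finally show ?thesis .
qed

text \<open>Some power l \<le> card G + 1 \<le> k of the matrix restricted to \<open>G\<close> has
  trace different from -1. If both alternatives failed for this l, the full trace would be -1 and
  would come from \<open>G\<close> alone.\<close>

lemma ex_periodic_vertex_or_closed_walk:
  assumes \<theta>: "\<And>x. x \<le> M \<Longrightarrow> \<theta> x \<le> M" and G: "G \<subseteq> {..<M}" "card G < k"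
  shows "\<exists>l\<in>{1..k}. (\<exists>x\<le>M. (\<theta> ^^ l) x = x) \<or>
    (\<exists>b\<in>{..<M} - G. (b, b) \<in> support_rel {..<M} (edge_cover \<theta>) ^^ l)"
proof -
  have "finite G" using G(1) finite_subset by blast
  then obtain l where l: "l \<in> {1..card G + 1}"
      "(\<Sum>i\<in>G. walk_weight G (edge_cover \<theta>) l i i) \<noteq> -1"
    using closed_walk_weight_ne_minus_one by blast
  have "(\<exists>x\<le>M. (\<theta> ^^ l) x = x) \<or>
    (\<exists>b\<in>{..<M} - G. (b, b) \<in> support_rel {..<M} (edge_cover \<theta>) ^^ l)"
  proof (rule ccontr)
    assume *: "\<not> ?thesis"
    have "-1 = (\<Sum>i<M. edge_cover (\<theta> ^^ l) i i)"
      by (rule sum_edge_cover_diag[symmetric]) (use * funpow_atMost[OF \<theta>] in auto)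
    also have "\<dots> = (\<Sum>i<M. walk_weight {..<M} (edge_cover \<theta>) l i i)"
      by (simp add: walk_weight_edge_cover[OF \<theta>])
    also have "\<dots> = (\<Sum>i\<in>G. walk_weight G (edge_cover \<theta>) l i i)"
      by (rule closed_walk_weight_restrict) (use * G(1) in blast)+
    finally show False using l(2) by simp
  qed
  then show ?thesis using l(1) G(2) by fastforce
qed

section \<open>Covering relations between intervals and periodic points of maps with a finite
  invariant set\<close>

lemma continuous_on_funpow_UNIV:
  fixes g :: "real \<Rightarrow> real"
  assumes "continuous_on UNIV g"
  shows "continuous_on S (g ^^ l)"
proof -
  have "continuous_on UNIV (g ^^ l)"
  proof (induction l)
    case (Suc l)
    then show ?case
      using continuous_on_compose[OF Suc continuous_on_subset[OF assms]] by (simp add: o_def)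
  qed (simp add: id_def)
  then show ?thesis by (rule continuous_on_subset) simp
qed

text \<open>At a preimage of a the function h x - x is at most 0, at a preimage of b it is at least
  0.\<close>

lemma interval_cover_fixed_point:
  fixes h :: "real \<Rightarrow> real"
  assumes "continuous_on {a..b} h" "a \<le> b" "{a..b} \<subseteq> h ` {a..b}"
  obtains x where "x \<in> {a..b}" "h x = x"
proof -
  have "a \<in> h ` {a..b}" "b \<in> h ` {a..b}"
    using assms(2) by (auto intro: subsetD[OF assms(3)])
  then obtain x y where xy: "x \<in> {a..b}" "a = h x" "y \<in> {a..b}" "b = h y"
    by (elim imageE)
  have "connected ((\<lambda>x. h x - x) ` {a..b})"
    by (rule connected_continuous_image) (use assms(1) in \<open>auto intro!: continuous_intros\<close>)
  then have "0 \<in> (\<lambda>x. h x - x) ` {a..b}"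
    by (rule connectedD_interval[of _ "h x - x" "h y - y"])
      (use xy in \<open>simp_all add: image_def bexI[of _ x] bexI[of _ y]\<close>)
  then show thesis by (auto intro: that)
qed

text \<open>A nonzero entry at (b, j) puts the images of the two ends of edge b on opposite sides of
  edge j, so by connectedness \<open>g\<close> maps edge b over edge j. Such coverings compose along
  a walk.\<close>

lemma relpow_imp_interval_cover:
  fixes p :: "nat \<Rightarrow> real"
  assumes g: "continuous_on UNIV g"
    and p: "mono_on {..M} p"
    and \<theta>: "\<And>x. x \<le> M \<Longrightarrow> \<theta> x \<le> M" "\<And>x. x \<le> M \<Longrightarrow> g (p x) = p (\<theta> x)"
    and walk: "(i, j) \<in> support_rel {..<M} (edge_cover \<theta>) ^^ l"
  shows "{p j..p (Suc j)} \<subseteq> (g ^^ l) ` {p i..p (Suc i)}"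
  using walk
proof (induction l arbitrary: j)
  case 0
  then show ?case by simp
next
  case (Suc l)
  then obtain b where b: "(i, b) \<in> support_rel {..<M} (edge_cover \<theta>) ^^ l"
    and bj: "b < M" "j < M" "edge_cover \<theta> b j \<noteq> 0"
    by auto
  have "{p j..p (Suc j)} \<subseteq> g ` {p b..p (Suc b)}"
  proof
    fix y assume y: "y \<in> {p j..p (Suc j)}"
    have conn: "connected (g ` {p b..p (Suc b)})"
      by (intro connected_continuous_image continuous_on_subset[OF g]) auto
    have le: "p b \<le> p (Suc b)" using p bj(1) by (auto simp: mono_on_def)
    have mem: "p (\<theta> b) \<in> g ` {p b..p (Suc b)}" "p (\<theta> (Suc b)) \<in> g ` {p b..p (Suc b)}"
      using \<theta>(2)[of b] \<theta>(2)[of "Suc b"] bj(1) le by (auto intro: rev_image_eqI)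
    have bound: "\<theta> b \<le> M" "\<theta> (Suc b) \<le> M" using \<theta>(1) bj(1) by auto
    have lower: "p x \<le> y" if "x \<le> j" for x
      using monotone_onD[OF p, of x j] that bj(2) y by auto
    have upper: "y \<le> p x" if "j < x" "x \<le> M" for x
      using monotone_onD[OF p, of "Suc j" x] that bj(2) y by auto
    from bj(3) consider "\<theta> b \<le> j" "j < \<theta> (Suc b)" | "\<theta> (Suc b) \<le> j" "j < \<theta> b"
      by (cases "\<theta> b \<le> j"; cases "\<theta> (Suc b) \<le> j") (auto simp: edge_cover_def)
    then show "y \<in> g ` {p b..p (Suc b)}"
      by cases (use connectedD_interval[OF conn] mem bound lower upper in metis)+
  qed
  also have "\<dots> \<subseteq> g ` (g ^^ l) ` {p i..p (Suc i)}"
    by (rule image_mono[OF Suc.IH[OF b]])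
  finally show ?case by (simp add: image_comp)
qed

lemma finite_invariant_set_periodic_point:
  fixes g :: "real \<Rightarrow> real"
  assumes g: "continuous_on UNIV g"
    and A: "finite A" "A \<noteq> {}" "g ` A \<subseteq> A" "A \<subseteq> (\<Union>c\<in>{1..k}. I c)"
    and I: "\<And>c. c \<in> {1..k} \<Longrightarrow> is_interval (I c)"
  shows "\<exists>x\<in>(\<Union>c\<in>{1..k}. I c). \<exists>l\<in>{1..k}. (g ^^ l) x = x"
proof -
  define p where "p = nth (sorted_list_of_set A)"
  define M where "M = card A - 1"
  have card: "card A = Suc M"
    using A(1,2) by (simp add: M_def card_gt_0_iff)
  have "strict_mono_on {..M} p"
    unfolding p_def strict_mono_on_def
    using sorted_wrt_nth_less[OF strict_sorted_list_of_set[of A]] by (simp add: card less_Suc_eq_le)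
  then have mono: "mono_on {..M} p" by (rule strict_mono_on_imp_mono_on)
  have pA: "p ` {..M} = A"
    using A(1) nth_image[of "Suc M" "sorted_list_of_set A"]
    by (simp add: p_def card lessThan_Suc_atMost atLeast0LessThan)
  then have "\<forall>x. \<exists>y. x \<le> M \<longrightarrow> y \<le> M \<and> g (p x) = p y"
    using A(3) by (metis atMost_iff image_eqI image_iff image_subset_iff)
  then obtain \<theta> where \<theta>: "\<And>x. x \<le> M \<Longrightarrow> \<theta> x \<le> M" "\<And>x. x \<le> M \<Longrightarrow> g (p x) = p (\<theta> x)"
    by metis
  have "\<exists>c. c \<in> {1..k} \<and> p x \<in> I c" if "x \<le> M" for x
  proof -
    have "p x \<in> A" using pA that by blast
    then show ?thesis using A(4) by blast
  qed
  then obtain c where c: "\<And>x. x \<le> M \<Longrightarrow> c x \<in> {1..k}" "\<And>x. x \<le> M \<Longrightarrow> p x \<in> I (c x)"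
    by metis
  \<comment> \<open>These are the edges not known to lie in one of the intervals; a closed walk
    through any other edge yields a fixed point of the iterate in the union.\<close>
  define G where "G = {i. i < M \<and> \<not> (\<exists>c\<in>{1..k}. p i \<in> I c \<and> p (Suc i) \<in> I c)}"
  \<comment> \<open>If \<open>p i\<close> and a later \<open>p j\<close> shared an interval, it would contain \<open>p (Suc i)\<close> as well.\<close>
  have ne: "c i \<noteq> c j" if "i \<in> G" "i < j" "j \<le> M" for i j
  proof
    assume eq: "c i = c j"
    have i: "i \<le> M" using that by simp
    have "p i \<le> p (Suc i)" "p (Suc i) \<le> p j"
      using monotone_onD[OF mono, of i "Suc i"] monotone_onD[OF mono, of "Suc i" j] that by auto
    moreover have "p i \<in> I (c i)" "p j \<in> I (c i)"
      using c(2)[OF i] c(2)[OF that(3)] by (simp_all only: eq)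
    ultimately have "p (Suc i) \<in> I (c i)"
      using mem_is_interval_1_I[OF I[OF c(1)[OF i]]] by blast
    then have "i \<notin> G" using c(1)[OF i] c(2)[OF i] unfolding G_def by blast
    then show False using that(1) by contradiction
  qed
  \<comment> \<open>Including the last vertex M, which starts no edge, turns the bound
    \<open>card G \<le> k\<close> into the strict one required.\<close>
  have "inj_on c (insert M G)"
  proof (rule linorder_inj_onI)
    fix i j assume "i < j" "i \<in> insert M G" "j \<in> insert M G"
    then show "c i \<noteq> c j" using ne[of i j] by (auto simp: G_def)
  qed auto
  moreover have "c ` insert M G \<subseteq> {1..k}"
    using c(1) by (force simp: G_def)
  ultimately have "card (insert M G) \<le> k"
    using card_inj_on_le[of c "insert M G" "{1..k}"] by simp
  moreover have "finite G" "M \<notin> G" by (auto simp: G_def)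
  ultimately have "card G < k" by simp
  moreover have "G \<subseteq> {..<M}" by (auto simp: G_def)
  ultimately obtain l where l: "l \<in> {1..k}" and
    "(\<exists>x\<le>M. (\<theta> ^^ l) x = x) \<or>
    (\<exists>b\<in>{..<M} - G. (b, b) \<in> support_rel {..<M} (edge_cover \<theta>) ^^ l)"
    using ex_periodic_vertex_or_closed_walk[of M \<theta>, OF \<theta>(1)] by blast
  then show ?thesis
  proof (elim disjE exE bexE conjE)
    fix x assume x: "x \<le> M" "(\<theta> ^^ l) x = x"
    have "(g ^^ m) (p x) = p ((\<theta> ^^ m) x)" for m
      using funpow_atMost[OF \<theta>(1) x(1)] by (induction m) (simp_all add: \<theta>(2))
    then have "(g ^^ l) (p x) = p x" using x(2) by simp
    then show ?thesis using c[OF x(1)] l by blast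
  next
    fix b assume b: "b \<in> {..<M} - G"
      "(b, b) \<in> support_rel {..<M} (edge_cover \<theta>) ^^ l"
    then obtain d where d: "d \<in> {1..k}" "p b \<in> I d" "p (Suc b) \<in> I d"
      by (auto simp: G_def)
    have "p b \<le> p (Suc b)"
      using monotone_onD[OF mono, of b "Suc b"] b(1) by auto
    then obtain x where x: "x \<in> {p b..p (Suc b)}" "(g ^^ l) x = x"
      using interval_cover_fixed_point[of "p b" "p (Suc b)" "g ^^ l"]
        relpow_imp_interval_cover[OF g mono \<theta> b(2)] continuous_on_funpow_UNIV[OF g] by blast
    then have "x \<in> I d"
      using mem_is_interval_1_I[OF I[OF d(1)] d(2,3)] by simp
    then show ?thesis using x l d by blast
  qed
qed

section \<open>Almost closed backward orbits and stability under small perturbations\<close>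

text \<open>By compactness, a backward orbit in \<open>U\<close> has two terms x i and x j with i <
  j that are closer than e. The map f moves the block between them one index back.\<close>

lemma finite_pseudo_invariant_subset:
  fixes f :: "'a::metric_space \<Rightarrow> 'a"
  assumes U: "compact U" "U \<noteq> {}" "U \<subseteq> f ` U" and "e > 0"
  obtains A \<theta> where "finite A" "A \<noteq> {}" "A \<subseteq> U" "\<And>a. a \<in> A \<Longrightarrow> \<theta> a \<in> A"
    "\<And>a. a \<in> A \<Longrightarrow> dist (\<theta> a) (f a) < e"
proof -
  obtain s where s: "\<And>y. y \<in> U \<Longrightarrow> s y \<in> U" "\<And>y. y \<in> U \<Longrightarrow> f (s y) = y"
  proof -
    have "\<exists>x. x \<in> U \<and> f x = y" if "y \<in> U" for y
      using subsetD[OF U(3) that] by blast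
    then show thesis using that by metis
  qed
  obtain u where "u \<in> U" using U(2) by blast
  define x where "x n = (s ^^ n) u" for n
  have xU: "x n \<in> U" for n
    by (induction n) (use s \<open>u \<in> U\<close> in \<open>auto simp: x_def\<close>)
  have fx: "f (x (Suc n)) = x n" for n
    using s(2)[OF xU[of n]] by (simp add: x_def)
  obtain r y where "strict_mono r" "(x \<circ> r) \<longlonglongrightarrow> y"
    using U(1) xU unfolding compact_def by metis
  then have "Cauchy (x \<circ> r)" using LIMSEQ_imp_Cauchy by blast
  then obtain n where n: "dist (x (r n)) (x (r (Suc n))) < e"
    using \<open>e > 0\<close> unfolding Cauchy_def by (metis comp_apply le_SucI order_refl)
  define i j where "i = r n" and "j = r (Suc n)"
  have ij: "i < j" "dist (x j) (x i) < e"
    using n \<open>strict_mono r\<close> by (auto simp: i_def j_def strict_mono_def dist_commute)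
  \<comment> \<open>Only the image x i of x (i + 1) may leave the block; the nearby x j takes its
    place.\<close>
  define A where "A = x ` {i<..j}"
  have "\<exists>a'\<in>A. dist a' (f a) < e" if "a \<in> A" for a
  proof -
    from that obtain t where t: "t \<in> {i<..j}" "a = x t" by (auto simp: A_def)
    then obtain t' where t': "t = Suc t'" by (cases t) auto
    show ?thesis
    proof (cases "t' = i")
      case True
      then show ?thesis using ij t t' fx[of t'] by (auto simp: A_def)
    next
      case False
      then have "x t' \<in> A" using t(1) t' by (simp add: A_def)
      then show ?thesis using t(2) t' fx[of t'] \<open>e > 0\<close> by (intro bexI[of _ "x t'"]) simp_all
    qed
  qed
  then obtain \<theta> where "\<And>a. a \<in> A \<Longrightarrow> \<theta> a \<in> A \<and> dist (\<theta> a) (f a) < e"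
    by metis
  moreover have "finite A" "A \<noteq> {}" "A \<subseteq> U"
    using ij(1) xU by (auto simp: A_def)
  ultimately show thesis using that by blast
qed

text \<open>In the induction step g z - f y is split into g z - f z, small by the choice of g, and f
  z - f y, small by uniform continuity on a compact ball.\<close>

lemma funpow_perturbation:
  fixes f :: "real \<Rightarrow> real"
  assumes f: "continuous_on UNIV f" and U: "compact U" and "d > 0"
  shows "\<exists>e>0. \<forall>g. (\<forall>y. \<bar>g y - f y\<bar> \<le> e) \<longrightarrow> (\<forall>x\<in>U. \<bar>(g ^^ l) x - (f ^^ l) x\<bar> < d)"
  using \<open>d > 0\<close>
proof (induction l arbitrary: d)
  case 0
  then show ?case by (auto intro: exI[of _ 1])
next
  case (Suc l)
  have "compact ((f ^^ l) ` U)"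
    by (rule compact_continuous_image[OF continuous_on_funpow_UNIV[OF f] U])
  then obtain R where R: "\<And>x. x \<in> U \<Longrightarrow> \<bar>(f ^^ l) x\<bar> \<le> R"
    by (force dest: compact_imp_bounded simp: bounded_iff)
  \<comment> \<open>The margin 1 leaves room for the perturbed iterate, which the bound
    \<open>min 1 \<delta>\<close> keeps within distance 1 of the original one.\<close>
  have "uniformly_continuous_on (cball 0 (R + 1)) f"
    by (intro compact_uniformly_continuous continuous_on_subset[OF f]) auto
  moreover have "d / 2 > 0" using Suc.prems by simp
  ultimately obtain \<delta> where \<delta>: "\<delta> > 0"
    "\<And>y z. y \<in> cball 0 (R + 1) \<Longrightarrow> z \<in> cball 0 (R + 1) \<Longrightarrow> dist z y < \<delta> \<Longrightarrow> dist (f z) (f y) < d / 2"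
    unfolding uniformly_continuous_on_def by meson
  have "min 1 \<delta> > 0" using \<delta>(1) by simp
  from Suc.IH[OF this] obtain e where e: "e > 0"
    "\<And>g x. \<forall>y. \<bar>g y - f y\<bar> \<le> e \<Longrightarrow> x \<in> U \<Longrightarrow> \<bar>(g ^^ l) x - (f ^^ l) x\<bar> < min 1 \<delta>"
    by blast
  show ?case
  proof (intro exI[of _ "min e (d / 2)"] conjI allI impI ballI)
    show "min e (d / 2) > 0" using e(1) Suc.prems by simp
    fix g x
    assume g: "\<forall>y. \<bar>g y - f y\<bar> \<le> min e (d / 2)" and x: "x \<in> U"
    define y z where "y = (f ^^ l) x" and "z = (g ^^ l) x"
    have yz: "\<bar>z - y\<bar> < min 1 \<delta>"
      using e(2)[of g x] g x by (simp add: y_def z_def)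
    moreover have "\<bar>y\<bar> \<le> R" using R[OF x] by (simp add: y_def)
    ultimately have "dist (f z) (f y) < d / 2"
      by (intro \<delta>(2)) (auto simp: dist_real_def)
    moreover have "\<bar>g z - f z\<bar> \<le> d / 2" using g by simp
    ultimately have "\<bar>g z - f y\<bar> < d" unfolding dist_real_def by linarith
    then show "\<bar>(g ^^ Suc l) x - (f ^^ Suc l) x\<bar> < d" by (simp add: y_def z_def)
  qed
qed

text \<open>The displacement of the l-th iterate attains a positive minimum on \<open>U\<close>;
  changing the iterate by less than this minimum creates no fixed point there.\<close>

lemma no_fixed_point_perturbation:
  fixes f :: "real \<Rightarrow> real"
  assumes f: "continuous_on UNIV f" and U: "compact U" "U \<noteq> {}"
    and "\<And>x. x \<in> U \<Longrightarrow> (f ^^ l) x \<noteq> x"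
  shows "\<exists>e>0. \<forall>g. (\<forall>y. \<bar>g y - f y\<bar> \<le> e) \<longrightarrow> (\<forall>x\<in>U. (g ^^ l) x \<noteq> x)"
proof -
  have "continuous_on U (\<lambda>x. \<bar>(f ^^ l) x - x\<bar>)"
    by (intro continuous_intros continuous_on_funpow_UNIV[OF f])
  then obtain x0 where x0: "x0 \<in> U" "\<And>x. x \<in> U \<Longrightarrow> \<bar>(f ^^ l) x0 - x0\<bar> \<le> \<bar>(f ^^ l) x - x\<bar>"
    using continuous_attains_inf[OF U] by blast
  have "\<bar>(f ^^ l) x0 - x0\<bar> > 0" using assms(4)[OF x0(1)] by simp
  from funpow_perturbation[OF f U(1) this, of l] x0(2) show ?thesis
    by (smt (verit))
qed

section \<open>Periodic points of covering systems, by perturbation to a finite invariant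
  set\<close>

theorem theorem1p2:
  fixes f :: "real \<Rightarrow> real" and I :: "nat \<Rightarrow> real set" and k :: nat
  assumes "k \<ge> 1"
    and "continuous_on UNIV f"
    and "\<And>i. i \<in> {1..k} \<Longrightarrow> is_interval (I i) \<and> closed (I i) \<and> bounded (I i) \<and> I i \<noteq> {}"
    and "covering_system k I f"
  shows "\<exists>x0 \<in> (\<Union>i\<in>{1..k}. I i). \<exists>l. 1 \<le> l \<and> l \<le> k \<and> (f ^^ l) x0 = x0"
proof (rule ccontr)
  assume *: "\<not> ?thesis"
  define U where "U = (\<Union>i\<in>{1..k}. I i)"
  note f = assms(2)
  have U: "compact U" "U \<noteq> {}" "U \<subseteq> f ` U"
    using assms(1,3,4) unfolding U_def covering_system_def
    by (auto intro!: compact_UN simp: compact_eq_bounded_closed)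
  have "\<exists>e>0. \<forall>g. (\<forall>y. \<bar>g y - f y\<bar> \<le> e) \<longrightarrow> (\<forall>x\<in>U. (g ^^ l) x \<noteq> x)" if "l \<in> {1..k}" for l
    by (rule no_fixed_point_perturbation[OF f U(1,2)]) (use * that in \<open>auto simp: U_def\<close>)
  then obtain e where e: "\<And>l. l \<in> {1..k} \<Longrightarrow> e l > 0"
    "\<And>l g x. l \<in> {1..k} \<Longrightarrow> \<forall>y. \<bar>g y - f y\<bar> \<le> e l \<Longrightarrow> x \<in> U \<Longrightarrow> (g ^^ l) x \<noteq> x"
    by metis
  \<comment> \<open>One bound for all l is needed, since the period of the perturbed map is only
    known afterwards.\<close>
  define \<epsilon> where "\<epsilon> = Min (e ` {1..k})"
  have \<epsilon>: "\<epsilon> > 0" "\<And>l. l \<in> {1..k} \<Longrightarrow> \<epsilon> \<le> e l"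
    using e(1) assms(1) by (auto simp: \<epsilon>_def)
  obtain A \<theta> where A: "finite A" "A \<noteq> {}" "A \<subseteq> U" "\<And>a. a \<in> A \<Longrightarrow> \<theta> a \<in> A"
    "\<And>a. a \<in> A \<Longrightarrow> dist (\<theta> a) (f a) < \<epsilon>"
    using finite_pseudo_invariant_subset[OF U \<epsilon>(1)] by metis
  \<comment> \<open>The correction from f to \<open>\<theta>\<close> on the finite set
    \<open>A\<close> extends continuously to the line with the same bound, so that f + h leaves
    \<open>A\<close> invariant and stays within \<epsilon> of f.\<close>
  obtain h where h: "continuous_on UNIV h" "\<And>x. x \<in> A \<Longrightarrow> h x = \<theta> x - f x"
    "\<And>x. norm (h x) \<le> \<epsilon>"
  proof (rule Tietze[of A "\<lambda>x. \<theta> x - f x" UNIV \<epsilon>])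
    show "continuous_on A (\<lambda>x. \<theta> x - f x)" by (rule continuous_on_finite[OF A(1)])
    show "closedin (top_of_set UNIV) A" using A(1) by (simp add: finite_imp_closed)
    show "norm (\<theta> x - f x) \<le> \<epsilon>" if "x \<in> A" for x
      using A(5)[OF that] by (simp add: dist_norm)
  qed (use \<epsilon>(1) in auto)
  define g where "g x = f x + h x" for x
  have "continuous_on UNIV g"
    unfolding g_def by (intro continuous_intros f h(1))
  moreover have "g ` A \<subseteq> A" using A(4) h(2) by (auto simp: g_def)
  ultimately obtain x l where "x \<in> U" "l \<in> {1..k}" "(g ^^ l) x = x"
    using finite_invariant_set_periodic_point[of g A I k] A(1-3) assms(3) unfolding U_def by blast
  moreover have "\<forall>y. \<bar>g y - f y\<bar> \<le> e l"
    using h(3) \<epsilon>(2)[OF \<open>l \<in> {1..k}\<close>] by (fastforce simp: g_def intro: order_trans)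
  ultimately show False using e(2) by blast
qed

end
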